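(* Let $G$ be a Garside group with a fixed Garside element $\Delta$. For every $g\in G$ and every integer $n\geqslant 1$: (1) $\inf_s(g)\leqslant \dfrac{\inf_s(g^n)}{n}<\inf_s(g)+1$; (2) $\sup_s(g)-1<\dfrac{\sup_s(g^n)}{n}\leqslant \sup_s(g)$; (3) $\mathrm{len}_s(g)-2<\dfrac{\mathrm{len}_s(g^n)}{n}\leqslant \mathrm{len}_s(g)$.
   Context: Garside monoids and groups. Let $M$ be a monoid. An atom of $M$ is an element $a\neq 1$ such that $a=bc$ with $b,c\in M$ implies $b=1$ or $c=1$. For $a\in M$ let $\|a\|$ be the supremum of the lengths of all expressions of $a$ as a product of atoms. $M$ is atomic if it is generated by its atoms and $\|a\|<\infty$ for all $a\in M$. In an atomic monoid: $a\leqslant_L b$ if $ac=b$ for some $c\in M$, and $a\leqslant_R b$ if $ca=b$ for some $c\in M$; $L(a)=\{b: b\leqslant_L a\}$, $R(a)=\{b: b\leqslant_R a\}$. An atomic monoid $M$ is a Garside monoid if it is finitely generated, left and right cancellative, $(M,\leqslant_L)$ and $(M,\leqslant_R)$ are lattices, and there is an element $\Delta\in M$ (a Garside element) such that $L(\Delta)=R(\Delta)$ and this set generates $M$. A Garside monoid embeds in its group of fractions; a Garside group $G$ is the group of fractions of a Garside monoid, denoted $G^+$. The order $\leqslant_L$ extends to $G$: $g\leqslant_L h$ if $gc=h$ for some $c\in G^+$. Invariants. For $g\in G$ there are integers $r,s$ with $\Delta^r\leqslant_L g\leqslant_L\Delta^s$; define $\inf(g)=\max\{r\in\mathbb Z:\Delta^r\leqslant_L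 g\}$, $\sup(g)=\min\{s\in\mathbb Z: g\leqslant_L\Delta^s\}$. With $[g]$ the conjugacy class of $g$ in $G$, set $\inf_s(g)=\max\{\inf(h):h\in[g]\}$, $\sup_s(g)=\min\{\sup(h):h\in[g]\}$ (these exist), and $\mathrm{len}_s(g)=\sup_s(g)-\inf_s(g)$. *)

theory Defs
  imports Complex_Main "HOL-Algebra.Group" "HOL-Algebra.Lattice" "HOL-Library.Extended_Nat"
begin

definition word_prod :: "('a, 'b) monoid_scheme \<Rightarrow> 'a list \<Rightarrow> 'a" where
  "word_prod M xs = foldr (\<lambda>x y. x \<otimes>\<^bsub>M\<^esub> y) xs \<one>\<^bsub>M\<^esub>"

definition generates :: "('a, 'b) monoid_scheme \<Rightarrow> 'a set \<Rightarrow> bool" where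
  "generates M A \<longleftrightarrow> A \<subseteq> carrier M \<and> (\<forall>a\<in>carrier M. \<exists>xs. set xs \<subseteq> A \<and> word_prod M xs = a)"

definition atoms :: "('a, 'b) monoid_scheme \<Rightarrow> 'a set" where
  "atoms M = {a \<in> carrier M. a \<noteq> \<one>\<^bsub>M\<^esub> \<and>
     (\<forall>b\<in>carrier M. \<forall>c\<in>carrier M. a = b \<otimes>\<^bsub>M\<^esub> c \<longrightarrow> b = \<one>\<^bsub>M\<^esub> \<or> c = \<one>\<^bsub>M\<^esub>)}"

definition atom_norm :: "('a, 'b) monoid_scheme \<Rightarrow> 'a \<Rightarrow> enat" where
  "atom_norm M a = (SUP xs \<in> {xs. set xs \<subseteq> atoms M \<and> word_prod M xs = a}. enat (length xs))"

locale atomic_monoid = monoid M for M (structure) +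
  assumes atoms_generate: "generates M (atoms M)"
    and norm_finite: "a \<in> carrier M \<Longrightarrow> atom_norm M a < \<infinity>"

definition left_le :: "('a, 'b) monoid_scheme \<Rightarrow> 'a \<Rightarrow> 'a \<Rightarrow> bool" where
  "left_le M a b \<longleftrightarrow> (\<exists>c\<in>carrier M. a \<otimes>\<^bsub>M\<^esub> c = b)"

definition right_le :: "('a, 'b) monoid_scheme \<Rightarrow> 'a \<Rightarrow> 'a \<Rightarrow> bool" where
  "right_le M a b \<longleftrightarrow> (\<exists>c\<in>carrier M. c \<otimes>\<^bsub>M\<^esub> a = b)"

definition left_divisors :: "('a, 'b) monoid_scheme \<Rightarrow> 'a \<Rightarrow> 'a set" where
  "left_divisors M a = {b \<in> carrier M. left_le M b a}"

definition right_divisors :: "('a, 'b) monoid_scheme \<Rightarrow> 'a \<Rightarrow> 'a set" where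
  "right_divisors M a = {b \<in> carrier M. right_le M b a}"

definition garside_element :: "('a, 'b) monoid_scheme \<Rightarrow> 'a \<Rightarrow> bool" where
  "garside_element M \<Delta> \<longleftrightarrow> \<Delta> \<in> carrier M \<and>
     left_divisors M \<Delta> = right_divisors M \<Delta> \<and> generates M (left_divisors M \<Delta>)"

locale garside_monoid = atomic_monoid +
  assumes finitely_generated: "\<exists>A. finite A \<and> generates M A"
    and left_cancel:
      "\<lbrakk>a \<in> carrier M; b \<in> carrier M; c \<in> carrier M; a \<otimes> b = a \<otimes> c\<rbrakk> \<Longrightarrow> b = c"
    and right_cancel:
      "\<lbrakk>a \<in> carrier M; b \<in> carrier M; c \<in> carrier M; b \<otimes> a = c \<otimes> a\<rbrakk> \<Longrightarrow> b = c"
    and left_lattice: "lattice \<lparr>carrier = carrier M, eq = (=), le = left_le M\<rparr>"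
    and right_lattice: "lattice \<lparr>carrier = carrier M, eq = (=), le = right_le M\<rparr>"
    and ex_garside_element: "\<exists>\<Delta>. garside_element M \<Delta>"

text \<open>
  The group of fractions of a cancellative monoid with common multiples is determined, up to
  isomorphism over the monoid, by containing the monoid as a submonoid and consisting of
  fractions of its elements. Accordingly the Garside monoid is given as a submonoid \<open>P\<close>
  (the positive monoid) of \<open>G\<close>.
\<close>

locale garside_group = group G + submonoid P G for G (structure) and P +
  assumes positive_garside: "garside_monoid (G\<lparr>carrier := P\<rparr>)"
    and fractions: "g \<in> carrier G \<Longrightarrow> \<exists>a\<in>P. \<exists>b\<in>P. g = inv a \<otimes> b"

definition group_left_le :: "('a, 'b) monoid_scheme \<Rightarrow> 'a set \<Rightarrow> 'a \<Rightarrow> 'a \<Rightarrow> bool" where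
  "group_left_le G P g h \<longleftrightarrow> (\<exists>c\<in>P. g \<otimes>\<^bsub>G\<^esub> c = h)"

text \<open>
  Maximum and minimum of a set of integers, with value 0 if there is none. The sets used below
  have a maximum (minimum) unless the group is trivial; there \<open>\<Delta> = \<one>\<close> and every power of \<open>\<Delta>\<close>
  is both a lower and an upper bound of the only element, and the convention gives that
  element infimum and supremum 0.
\<close>

definition int_max :: "int set \<Rightarrow> int" where
  "int_max S = (if \<exists>m\<in>S. \<forall>x\<in>S. x \<le> m then THE m. m \<in> S \<and> (\<forall>x\<in>S. x \<le> m) else 0)"

definition int_min :: "int set \<Rightarrow> int" where
  "int_min S = (if \<exists>m\<in>S. \<forall>x\<in>S. m \<le> x then THE m. m \<in> S \<and> (\<forall>x\<in>S. m \<le> x) else 0)"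

lemma int_max_eqI: "m \<in> S \<Longrightarrow> (\<And>x. x \<in> S \<Longrightarrow> x \<le> m) \<Longrightarrow> int_max S = m"
  unfolding int_max_def by (auto intro!: the_equality intro: order.antisym)

lemma int_min_eqI: "m \<in> S \<Longrightarrow> (\<And>x. x \<in> S \<Longrightarrow> m \<le> x) \<Longrightarrow> int_min S = m"
  unfolding int_min_def by (auto intro!: the_equality intro: order.antisym)

definition garside_inf :: "('a, 'b) monoid_scheme \<Rightarrow> 'a set \<Rightarrow> 'a \<Rightarrow> 'a \<Rightarrow> int" where
  "garside_inf G P \<Delta> g = int_max {r :: int. group_left_le G P (\<Delta> [^]\<^bsub>G\<^esub> r) g}"

definition garside_sup :: "('a, 'b) monoid_scheme \<Rightarrow> 'a set \<Rightarrow> 'a \<Rightarrow> 'a \<Rightarrow> int" where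
  "garside_sup G P \<Delta> g = int_min {s :: int. group_left_le G P g (\<Delta> [^]\<^bsub>G\<^esub> s)}"

definition conjugacy_class :: "('a, 'b) monoid_scheme \<Rightarrow> 'a \<Rightarrow> 'a set" where
  "conjugacy_class G g = {inv\<^bsub>G\<^esub> x \<otimes>\<^bsub>G\<^esub> g \<otimes>\<^bsub>G\<^esub> x | x. x \<in> carrier G}"

definition inf_s :: "('a, 'b) monoid_scheme \<Rightarrow> 'a set \<Rightarrow> 'a \<Rightarrow> 'a \<Rightarrow> int" where
  "inf_s G P \<Delta> g = int_max (garside_inf G P \<Delta> ` conjugacy_class G g)"

definition sup_s :: "('a, 'b) monoid_scheme \<Rightarrow> 'a set \<Rightarrow> 'a \<Rightarrow> 'a \<Rightarrow> int" where
  "sup_s G P \<Delta> g = int_min (garside_sup G P \<Delta> ` conjugacy_class G g)"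

definition len_s :: "('a, 'b) monoid_scheme \<Rightarrow> 'a set \<Rightarrow> 'a \<Rightarrow> 'a \<Rightarrow> int" where
  "len_s G P \<Delta> g = sup_s G P \<Delta> g - inf_s G P \<Delta> g"

end

theory Submission
  imports Defs
begin

text \<open>
  Right multiplication by powers of \<open>\<Delta>\<close> and left multiplication by any element are automorphisms
  of the left order \<open>\<preceq>\<close>, so \<open>T x = g x \<Delta>\<^sup>-\<^sup>k\<close> is one as well. Some conjugate of \<open>g\<close> has infimum at
  least \<open>k\<close> iff \<open>x \<preceq> T x\<close> for some \<open>x\<close>, and some conjugate of \<open>g\<^sup>n\<close> has infimum at least \<open>n k\<close> iff
  \<open>x \<preceq> T\<^sup>n x\<close> for some \<open>x\<close>. The first clearly implies the second; conversely, if \<open>x \<preceq> T\<^sup>n x\<close>, then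
  the meet \<open>a\<close> of \<open>x, T x, \<dots>, T\<^sup>n\<^sup>-\<^sup>1 x\<close> satisfies \<open>a \<preceq> T a\<close>. This gives (1). Inversion exchanges
  infima and suprema up to sign, which gives (2), and (3) is the difference of (2) and (1).
\<close>

section \<open>Maxima and minima of sets of integers\<close>

text \<open>Elements below the given \<open>s\<close> cannot matter, so the maximum is attained on
  the finite part of \<open>S\<close> in the interval from \<open>s\<close> to
  \<open>B\<close>.\<close>

lemma int_max_bounded:
  fixes S :: "int set"
  assumes "s \<in> S" and "\<And>x. x \<in> S \<Longrightarrow> x \<le> B"
  shows "int_max S \<in> S" and "\<And>x. x \<in> S \<Longrightarrow> x \<le> int_max S"
proof -
  define F where "F = S \<inter> {s..B}"
  have F: "finite F" "s \<in> F" unfolding F_def using assms by auto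
  then have "Max F \<in> F" by (metis Max_in empty_iff)
  moreover have "x \<le> Max F" if "x \<in> S" for x
  proof (cases "x \<ge> s")
    case True
    then show ?thesis using that F assms(2) by (auto simp: F_def)
  next
    case False
    then show ?thesis using Max_ge[OF F] by linarith
  qed
  ultimately have *: "Max F \<in> S" "\<And>x. x \<in> S \<Longrightarrow> x \<le> Max F" by (auto simp: F_def)
  then have "int_max S = Max F" by (intro int_max_eqI) auto
  with * show "int_max S \<in> S" "\<And>x. x \<in> S \<Longrightarrow> x \<le> int_max S" by auto
qed

text \<open>Holds without any existence hypothesis: if one extremum is missing so is the other, and
  the default 0 is its own negative.\<close>

lemma int_min_uminus: "int_min (uminus ` S) = - int_max S"
proof (cases "\<exists>m\<in>S. \<forall>x\<in>S. x \<le> m")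
  case True
  then obtain m where m: "m \<in> S" "\<And>x. x \<in> S \<Longrightarrow> x \<le> m" by blast
  then have "int_max S = m" by (intro int_max_eqI) auto
  moreover have "int_min (uminus ` S) = - m" using m by (intro int_min_eqI) auto
  ultimately show ?thesis by simp
next
  case False
  then show ?thesis by (auto simp: int_max_def int_min_def)
qed

section \<open>Words in monoids and units of atomic monoids\<close>

lemma (in monoid) word_prod_closed: "set xs \<subseteq> carrier G \<Longrightarrow> word_prod G xs \<in> carrier G"
  by (induction xs) (auto simp: word_prod_def)

lemma (in monoid) word_prod_append:
  "set xs \<subseteq> carrier G \<Longrightarrow> set ys \<subseteq> carrier G \<Longrightarrow>
    word_prod G (xs @ ys) = word_prod G xs \<otimes> word_prod G ys"
proof (induction xs)
  case Nil
  then show ?case using word_prod_closed[of ys] by (simp add: word_prod_def)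
next
  case (Cons x xs)
  then show ?case using word_prod_closed[of xs] word_prod_closed[of ys]
    by (simp add: word_prod_def m_assoc)
qed

text \<open>A word of atoms representing \<open>\<one>\<close> could be repeated to make the norm of \<open>\<one>\<close> infinite.\<close>

lemma (in atomic_monoid) factor_of_one_eq_one:
  assumes ab: "a \<in> carrier M" "b \<in> carrier M" "a \<otimes> b = \<one>"
  shows "a = \<one>"
proof (rule ccontr)
  assume "a \<noteq> \<one>"
  have atoms: "atoms M \<subseteq> carrier M" by (auto simp: atoms_def)
  obtain xs ys where xs: "set xs \<subseteq> atoms M" "word_prod M xs = a"
    and ys: "set ys \<subseteq> atoms M" "word_prod M ys = b"
    using atoms_generate ab unfolding generates_def by meson
  have "xs \<noteq> []" using xs \<open>a \<noteq> \<one>\<close> by (auto simp: word_prod_def)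
  define w where "w = xs @ ys"
  have w: "set w \<subseteq> atoms M" "w \<noteq> []" using xs ys \<open>xs \<noteq> []\<close> by (auto simp: w_def)
  have w1: "word_prod M w = \<one>"
    using word_prod_append[of xs ys] xs ys atoms ab by (auto simp: w_def)
  have rep: "set (concat (replicate k w)) \<subseteq> atoms M \<and> word_prod M (concat (replicate k w)) = \<one> \<and>
      k \<le> length (concat (replicate k w))" for k
  proof (induction k)
    case 0
    then show ?case by (simp add: word_prod_def)
  next
    case (Suc k)
    then have "set (concat (replicate k w)) \<subseteq> carrier M" "set w \<subseteq> carrier M"
      using w atoms by blast+
    then have "word_prod M (w @ concat (replicate k w)) = \<one>"
      using Suc w1 by (subst word_prod_append) auto
    moreover have "length w \<ge> 1" using w by (cases w) auto
    ultimately show ?case using Suc w by simp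
  qed
  have "enat k \<le> atom_norm M \<one>" for k
  proof -
    have "enat k \<le> enat (length (concat (replicate k w)))" using rep[of k] by simp
    also have "\<dots> \<le> atom_norm M \<one>"
      unfolding atom_norm_def using rep[of k] by (intro SUP_upper) simp
    finally show ?thesis .
  qed
  moreover obtain N where "atom_norm M \<one> = enat N"
    using norm_finite[OF one_closed] by (cases "atom_norm M \<one>") auto
  ultimately have "enat (Suc N) \<le> enat N" by metis
  then show False by simp
qed

section \<open>Cancellation and conjugation in groups\<close>

context group
begin

lemma inv_mult_cancel_left: "x \<in> carrier G \<Longrightarrow> y \<in> carrier G \<Longrightarrow> inv x \<otimes> (x \<otimes> y) = y"
  by (simp add: m_assoc[symmetric])

lemma mult_inv_cancel_left: "x \<in> carrier G \<Longrightarrow> y \<in> carrier G \<Longrightarrow> x \<otimes> (inv x \<otimes> y) = y"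
  by (simp add: m_assoc[symmetric])

lemmas group_cancel = m_assoc inv_mult_group inv_mult_cancel_left mult_inv_cancel_left

lemma inv_image_conjugacy_class:
  assumes "g \<in> carrier G"
  shows "m_inv G ` conjugacy_class G g = conjugacy_class G (inv g)"
proof -
  have "inv (inv x \<otimes> g \<otimes> x) = inv x \<otimes> inv g \<otimes> x" if "x \<in> carrier G" for x
    using assms that by (simp add: group_cancel)
  then show ?thesis by (force simp: conjugacy_class_def image_def)
qed

end

section \<open>The left order on the group\<close>

locale garside_group_with_element = garside_group +
  fixes \<Delta>
  assumes garside: "garside_element (G\<lparr>carrier := P\<rparr>) \<Delta>"
begin

abbreviation prec (infix "\<preceq>" 50) where "x \<preceq> y \<equiv> group_left_le G P x y"

lemma positive_closed: "x \<in> P \<Longrightarrow> x \<in> carrier G"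
  using subset by blast

lemma positive_mult: "x \<in> P \<Longrightarrow> y \<in> P \<Longrightarrow> x \<otimes> y \<in> P"
  using submonoid_axioms by (rule submonoid.m_closed)

lemma positive_one: "\<one> \<in> P"
  using submonoid_axioms by (rule submonoid.one_closed)

lemma Delta_positive: "\<Delta> \<in> P"
  using garside by (simp add: garside_element_def)

lemma Delta_closed [simp]: "\<Delta> \<in> carrier G"
  using Delta_positive positive_closed by blast

text \<open>The witness \<open>c\<close> can only be \<open>inv x \<otimes> y\<close>. Order
  statements thus become membership in \<open>P\<close>, which the simplifier settles by
  cancellation.\<close>

lemma le_iff:
  assumes "x \<in> carrier G" "y \<in> carrier G"
  shows "x \<preceq> y \<longleftrightarrow> inv x \<otimes> y \<in> P"
proof
  assume "x \<preceq> y"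
  then obtain c where "c \<in> P" "x \<otimes> c = y" by (auto simp: group_left_le_def)
  then show "inv x \<otimes> y \<in> P" using assms positive_closed inv_mult_cancel_left by auto
next
  assume "inv x \<otimes> y \<in> P"
  then show "x \<preceq> y" unfolding group_left_le_def
    using assms mult_inv_cancel_left by blast
qed

lemma le_refl: "x \<in> carrier G \<Longrightarrow> x \<preceq> x"
  by (simp add: le_iff positive_one)

lemma le_trans:
  assumes "x \<preceq> y" "y \<preceq> z" "x \<in> carrier G"
  shows "x \<preceq> z"
proof -
  obtain c d where "c \<in> P" "d \<in> P" "x \<otimes> c = y" "y \<otimes> d = z"
    using assms by (auto simp: group_left_le_def)
  then have "x \<otimes> (c \<otimes> d) = z" using assms positive_closed by (metis m_assoc)
  then show ?thesis using \<open>c \<in> P\<close> \<open>d \<in> P\<close> positive_mult unfolding group_left_le_def by blast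
qed

lemma le_mult_left:
  assumes "x \<in> carrier G" "y \<in> carrier G" "z \<in> carrier G"
  shows "z \<otimes> x \<preceq> z \<otimes> y \<longleftrightarrow> x \<preceq> y"
  using assms by (simp add: le_iff group_cancel)

section \<open>Properties inherited from the positive monoid\<close>

lemma positive_units_trivial:
  assumes "a \<in> P" "inv a \<in> P"
  shows "a = \<one>"
proof -
  interpret M: garside_monoid "G\<lparr>carrier := P\<rparr>" by (rule positive_garside)
  show ?thesis using M.factor_of_one_eq_one[of a "inv a"] assms positive_closed by simp
qed

lemma positive_meet:
  assumes "x \<in> P" "y \<in> P"
  obtains d where "d \<in> P" "d \<preceq> x" "d \<preceq> y" "\<And>z. z \<in> P \<Longrightarrow> z \<preceq> x \<Longrightarrow> z \<preceq> y \<Longrightarrow> z \<preceq> d"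
proof -
  let ?M = "G\<lparr>carrier := P\<rparr>"
  let ?L = "\<lparr>carrier = carrier ?M, eq = (=), le = left_le ?M\<rparr>"
  interpret M: garside_monoid ?M by (rule positive_garside)
  interpret L: lattice ?L by (rule M.left_lattice)
  obtain d where "greatest ?L d (Lower ?L {x, y})"
    using L.inf_of_two_exists[of x y] assms by auto
  then show ?thesis using assms that[of d]
    by (auto simp: greatest_def Lower_def left_le_def group_left_le_def)
qed

text \<open>Induction on a word in divisors of \<open>\<Delta>\<close>, which generate
  \<open>P\<close>. Each letter \<open>s\<close> comes with its complement \<open>t\<close>.\<close>

lemma positive_induct [consumes 1, case_names one mult]:
  assumes "x \<in> P" and one: "Q \<one>"
    and mult: "\<And>s t y. s \<in> P \<Longrightarrow> t \<in> P \<Longrightarrow> s \<otimes> t = \<Delta> \<Longrightarrow> y \<in> P \<Longrightarrow> Q y \<Longrightarrow> Q (s \<otimes> y)"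
  shows "Q x"
proof -
  let ?M = "G\<lparr>carrier := P\<rparr>"
  obtain xs where xs: "set xs \<subseteq> left_divisors ?M \<Delta>" "word_prod ?M xs = x"
    using garside assms(1) unfolding garside_element_def generates_def by auto
  from xs(1) have "word_prod ?M xs \<in> P \<and> Q (word_prod ?M xs)"
  proof (induction xs)
    case Nil
    then show ?case using one positive_one by (simp add: word_prod_def)
  next
    case (Cons s xs)
    then obtain t where "s \<in> P" "t \<in> P" "s \<otimes> t = \<Delta>"
      by (auto simp: left_divisors_def left_le_def)
    then show ?case using Cons mult positive_mult by (simp add: word_prod_def)
  qed
  then show ?thesis using xs by simp
qed

lemma Delta_divisor_iff:
  assumes "s \<in> P"
  shows "(\<exists>t\<in>P. s \<otimes> t = \<Delta>) \<longleftrightarrow> (\<exists>t\<in>P. t \<otimes> s = \<Delta>)"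
proof -
  have "s \<in> left_divisors (G\<lparr>carrier := P\<rparr>) \<Delta> \<longleftrightarrow> s \<in> right_divisors (G\<lparr>carrier := P\<rparr>) \<Delta>"
    using garside by (simp add: garside_element_def)
  then show ?thesis using assms
    by (simp add: left_divisors_def right_divisors_def left_le_def right_le_def)
qed

section \<open>Conjugation by powers of \<open>\<Delta>\<close>\<close>

text \<open>Taking the complement twice is conjugation: from \<open>s \<otimes> t = \<Delta>\<close>
  and \<open>t \<otimes> u = \<Delta>\<close> follows \<open>s \<otimes> \<Delta> = s \<otimes> t
  \<otimes> u = \<Delta> \<otimes> u\<close>. The second complement \<open>u\<close> exists because
  left and right divisors of \<open>\<Delta>\<close> coincide.\<close>

lemma positive_conj_Delta: "x \<in> P \<Longrightarrow> inv \<Delta> \<otimes> x \<otimes> \<Delta> \<in> P"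
proof (induction rule: positive_induct)
  case one
  then show ?case by (simp add: positive_one)
next
  case (mult s t y)
  obtain u where u: "u \<in> P" "t \<otimes> u = \<Delta>" using Delta_divisor_iff mult by blast
  have "s \<otimes> \<Delta> = \<Delta> \<otimes> u" using mult u positive_closed by (metis m_assoc)
  then have "inv \<Delta> \<otimes> s \<otimes> \<Delta> = u" using mult u positive_closed by (simp add: group_cancel)
  moreover have "inv \<Delta> \<otimes> (s \<otimes> y) \<otimes> \<Delta> = (inv \<Delta> \<otimes> s \<otimes> \<Delta>) \<otimes> (inv \<Delta> \<otimes> y \<otimes> \<Delta>)"
    using mult positive_closed by (simp add: group_cancel)
  ultimately show ?case using u mult positive_mult by simp
qed

text \<open>Mirror image, with complements taken on the left: \<open>\<Delta> \<otimes> s = u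
  \<otimes> v \<otimes> s = u \<otimes> \<Delta>\<close>.\<close>

lemma positive_conj_inv_Delta: "x \<in> P \<Longrightarrow> \<Delta> \<otimes> x \<otimes> inv \<Delta> \<in> P"
proof (induction rule: positive_induct)
  case one
  then show ?case by (simp add: positive_one)
next
  case (mult s t y)
  obtain v where v: "v \<in> P" "v \<otimes> s = \<Delta>" using Delta_divisor_iff mult by blast
  obtain u where u: "u \<in> P" "u \<otimes> v = \<Delta>" using Delta_divisor_iff v mult by blast
  have "\<Delta> \<otimes> s = u \<otimes> \<Delta>" using mult u v positive_closed by (metis m_assoc)
  then have "\<Delta> \<otimes> s \<otimes> inv \<Delta> = u" using mult u positive_closed by (simp add: group_cancel)
  moreover have "\<Delta> \<otimes> (s \<otimes> y) \<otimes> inv \<Delta> = (\<Delta> \<otimes> s \<otimes> inv \<Delta>) \<otimes> (\<Delta> \<otimes> y \<otimes> inv \<Delta>)"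
    using mult positive_closed by (simp add: group_cancel)
  ultimately show ?case using u mult positive_mult by simp
qed

lemma Delta_pow_add: "\<Delta> [^] (i + j :: int) = \<Delta> [^] i \<otimes> \<Delta> [^] j"
  by (simp add: int_pow_mult)

lemma inv_Delta_pow: "inv (\<Delta> [^] (i :: int)) = \<Delta> [^] (- i)"
  by (simp add: int_pow_neg)

lemma positive_conj_Delta_pow:
  assumes "x \<in> P"
  shows "\<Delta> [^] (- k) \<otimes> x \<otimes> \<Delta> [^] (k :: int) \<in> P"
proof (induction k rule: int_induct[where k = 0])
  case base
  then show ?case using assms positive_closed by simp
next
  case (step1 i)
  have "\<Delta> [^] (- (i + 1)) \<otimes> x \<otimes> \<Delta> [^] (i + 1) =
      inv \<Delta> \<otimes> (\<Delta> [^] (- i) \<otimes> x \<otimes> \<Delta> [^] i) \<otimes> \<Delta>"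
    using assms positive_closed
    by (simp add: inv_Delta_pow[symmetric] Delta_pow_add group_cancel del: minus_add_distrib)
  then show ?case using positive_conj_Delta step1 by simp
next
  case (step2 i)
  have i: "\<Delta> [^] i = \<Delta> [^] (i - 1) \<otimes> \<Delta>" using Delta_pow_add[of "i - 1" 1] by simp
  have "\<Delta> [^] (- (i - 1)) \<otimes> x \<otimes> \<Delta> [^] (i - 1) =
      \<Delta> \<otimes> (\<Delta> [^] (- i) \<otimes> x \<otimes> \<Delta> [^] i) \<otimes> inv \<Delta>"
    using assms positive_closed
    by (simp add: inv_Delta_pow[symmetric] i group_cancel del: minus_diff_eq)
  then show ?case using positive_conj_inv_Delta step2 by simp
qed

text \<open>The quotient of the two new elements is the old quotient
  \<open>inv x \<otimes> y\<close> conjugated by \<open>\<Delta> [^] k\<close>, hence still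
  positive.\<close>

lemma le_mult_Delta_pow:
  assumes "x \<in> carrier G" "y \<in> carrier G" "x \<preceq> y"
  shows "x \<otimes> \<Delta> [^] (k :: int) \<preceq> y \<otimes> \<Delta> [^] k"
  using assms positive_conj_Delta_pow[of "inv x \<otimes> y" k]
  by (simp add: le_iff group_cancel inv_Delta_pow)

section \<open>Powers of \<open>\<Delta>\<close> as bounds\<close>

lemma positive_le_Delta_pow:
  assumes "x \<in> P"
  obtains k :: int where "x \<preceq> \<Delta> [^] k"
proof -
  from assms have "\<exists>k::int. x \<preceq> \<Delta> [^] k"
  proof (induction rule: positive_induct)
    case one
    have "\<one> \<preceq> \<Delta> [^] (0::int)" using le_refl by simp
    then show ?case by blast
  next
    case (mult s t y)
    then obtain k :: int where k: "y \<preceq> \<Delta> [^] k" by blast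
    have "s \<otimes> y \<preceq> s \<otimes> \<Delta> [^] k" using k mult positive_closed le_mult_left by simp
    moreover have "s \<otimes> \<Delta> [^] k \<preceq> \<Delta> \<otimes> \<Delta> [^] k"
      using mult positive_closed by (intro le_mult_Delta_pow) (auto simp: group_left_le_def)
    ultimately have "s \<otimes> y \<preceq> \<Delta> [^] (1 + k)"
      using le_trans mult positive_closed Delta_pow_add[of 1 k] by auto
    then show ?case by blast
  qed
  then show ?thesis using that by blast
qed

text \<open>The two sides assert positivity of \<open>inv h \<otimes> \<Delta> [^] s\<close> and of
  \<open>\<Delta> [^] s \<otimes> inv h\<close>, which are conjugate by
  \<open>\<Delta> [^] s\<close>. This is the source of the duality between infimum and
  supremum.\<close>

lemma le_Delta_pow_iff_inv:
  assumes "h \<in> carrier G"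
  shows "h \<preceq> \<Delta> [^] (s :: int) \<longleftrightarrow> \<Delta> [^] (- s) \<preceq> inv h"
proof
  assume "h \<preceq> \<Delta> [^] s"
  then have "\<Delta> [^] s \<otimes> (inv h \<otimes> \<Delta> [^] s) \<otimes> \<Delta> [^] (- s) \<in> P"
    using positive_conj_Delta_pow[of "inv h \<otimes> \<Delta> [^] s" "- s"] assms by (simp add: le_iff)
  then show "\<Delta> [^] (- s) \<preceq> inv h"
    using assms by (simp add: le_iff inv_Delta_pow[symmetric] group_cancel)
next
  assume "\<Delta> [^] (- s) \<preceq> inv h"
  then have "\<Delta> [^] (- s) \<otimes> (\<Delta> [^] s \<otimes> inv h) \<otimes> \<Delta> [^] s \<in> P"
    using positive_conj_Delta_pow[of "\<Delta> [^] s \<otimes> inv h" s] assms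
    by (simp add: le_iff inv_Delta_pow)
  then show "h \<preceq> \<Delta> [^] s"
    using assms by (simp add: le_iff inv_Delta_pow[symmetric] group_cancel)
qed

text \<open>For a fraction \<open>inv a \<otimes> b\<close> the claim reads
  \<open>b \<preceq> a \<otimes> \<Delta> [^] k\<close>, and a power above \<open>b\<close> only
  grows when \<open>a\<close> is put in front of it.\<close>

lemma le_Delta_pow:
  assumes "g \<in> carrier G"
  obtains k :: int where "g \<preceq> \<Delta> [^] k"
proof -
  obtain a b where ab: "a \<in> P" "b \<in> P" "g = inv a \<otimes> b" using fractions assms by blast
  obtain k :: int where k: "b \<preceq> \<Delta> [^] k" using positive_le_Delta_pow ab by blast
  have "\<one> \<preceq> a" using ab positive_closed by (simp add: le_iff)
  then have "\<Delta> [^] k \<preceq> a \<otimes> \<Delta> [^] k"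
    using le_mult_Delta_pow[of \<one> a k] ab positive_closed by simp
  then have "b \<preceq> a \<otimes> \<Delta> [^] k" using k le_trans ab positive_closed by blast
  then have "g \<preceq> \<Delta> [^] k" using ab positive_closed by (simp add: le_iff group_cancel)
  then show ?thesis using that by blast
qed

lemma Delta_pow_le:
  assumes "g \<in> carrier G"
  obtains k :: int where "\<Delta> [^] k \<preceq> g"
proof -
  obtain k :: int where "inv g \<preceq> \<Delta> [^] k" using le_Delta_pow assms by blast
  then have "\<Delta> [^] (- k) \<preceq> g" using le_Delta_pow_iff_inv[of "inv g" k] assms by simp
  then show ?thesis using that by blast
qed

lemma Delta_pow_positive: "0 \<le> k \<Longrightarrow> \<Delta> [^] (k :: int) \<in> P"
proof (induction k rule: int_ge_induct)
  case base
  then show ?case by (simp add: positive_one)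
next
  case (step i)
  then show ?case using positive_mult Delta_positive by (simp add: Delta_pow_add)
qed

lemma Delta_pow_mono: "i \<le> j \<Longrightarrow> \<Delta> [^] (i :: int) \<preceq> \<Delta> [^] j"
  using Delta_pow_positive[of "j - i"] Delta_pow_add[of "- i" j] by (simp add: le_iff inv_Delta_pow)

text \<open>If \<open>j < i\<close>, then \<open>\<Delta> [^] (j - i)\<close> and
  \<open>\<Delta> [^] (i - j - 1)\<close> are both positive. Their product is
  \<open>inv \<Delta>\<close>, so \<open>\<Delta>\<close> would be a unit of
  \<open>P\<close>.\<close>

lemma Delta_pow_le_imp_le:
  assumes "\<Delta> \<noteq> \<one>" "\<Delta> [^] (i :: int) \<preceq> \<Delta> [^] j"
  shows "i \<le> j"
proof (rule ccontr)
  assume "\<not> i \<le> j"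
  then have "\<Delta> [^] (i - j - 1) \<in> P" using Delta_pow_positive by simp
  moreover have "\<Delta> [^] (j - i) \<in> P"
    using assms(2) Delta_pow_add[of "- i" j] by (simp add: le_iff inv_Delta_pow)
  ultimately have "\<Delta> [^] (i - j - 1 + (j - i)) \<in> P" unfolding Delta_pow_add by (rule positive_mult)
  moreover have "i - j - 1 + (j - i) = - 1" by simp
  ultimately have "\<Delta> [^] (- 1 :: int) \<in> P" by metis
  then have "inv \<Delta> \<in> P" using inv_Delta_pow[of 1] by simp
  then show False using positive_units_trivial Delta_positive assms by blast
qed

text \<open>Divisors of \<open>\<Delta> = \<one>\<close> are units of \<open>P\<close>, hence
  trivial, and they generate \<open>P\<close>. This settles the case in which powers of
  \<open>\<Delta>\<close> are not distinct.\<close>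

lemma carrier_trivial:
  assumes "\<Delta> = \<one>"
  shows "carrier G = {\<one>}"
proof -
  have P: "x = \<one>" if "x \<in> P" for x
    using that
  proof (induction rule: positive_induct)
    case (mult s t y)
    then have "inv s = t" using assms positive_closed by (metis inv_equality inv_comm)
    then have "s = \<one>" using mult(1,2) positive_units_trivial by blast
    then show ?case using mult by simp
  qed simp
  have "g = \<one>" if g: "g \<in> carrier G" for g
  proof -
    obtain a b where ab: "a \<in> P" "b \<in> P" "g = inv a \<otimes> b" using fractions[OF g] by blast
    then show ?thesis using P[OF ab(1)] P[OF ab(2)] by simp
  qed
  then show ?thesis using one_closed by blast
qed

section \<open>Meets in the group\<close>

lemma common_Delta_pow_le:
  assumes "x \<in> carrier G" "y \<in> carrier G"
  obtains k :: int where "\<Delta> [^] k \<preceq> x" "\<Delta> [^] k \<preceq> y"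
proof -
  obtain i j :: int where ij: "\<Delta> [^] i \<preceq> x" "\<Delta> [^] j \<preceq> y" using Delta_pow_le assms by metis
  have "\<Delta> [^] min i j \<preceq> x" by (rule le_trans[OF Delta_pow_mono ij(1)]) simp_all
  moreover have "\<Delta> [^] min i j \<preceq> y" by (rule le_trans[OF Delta_pow_mono ij(2)]) simp_all
  ultimately show ?thesis by (rule that)
qed

text \<open>\<open>P\<close> provides meets of positive elements only. Translating by a common lower
  bound \<open>m\<close> makes \<open>x\<close> and \<open>y\<close> positive; it remains to compare
  the result with lower bounds that are not above \<open>m\<close>.\<close>

lemma binary_meet:
  assumes xy: "x \<in> carrier G" "y \<in> carrier G"
  obtains a where "a \<in> carrier G" "\<And>z. z \<in> carrier G \<Longrightarrow> z \<preceq> a \<longleftrightarrow> z \<preceq> x \<and> z \<preceq> y"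
proof -
  obtain i :: int where "\<Delta> [^] i \<preceq> x" "\<Delta> [^] i \<preceq> y" using common_Delta_pow_le xy by blast
  then obtain m where m: "m \<in> carrier G" and mx: "m \<preceq> x" "m \<preceq> y"
    using Delta_closed int_pow_closed by blast
  obtain d where d: "d \<in> P" "d \<preceq> inv m \<otimes> x" "d \<preceq> inv m \<otimes> y"
    "\<And>z. z \<in> P \<Longrightarrow> z \<preceq> inv m \<otimes> x \<Longrightarrow> z \<preceq> inv m \<otimes> y \<Longrightarrow> z \<preceq> d"
    using positive_meet[of "inv m \<otimes> x" "inv m \<otimes> y"] mx m xy by (auto simp: le_iff)
  have shift: "m \<otimes> u \<preceq> v \<longleftrightarrow> u \<preceq> inv m \<otimes> v" if "u \<in> carrier G" "v \<in> carrier G" for u v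
    using that m by (simp add: le_iff group_cancel)
  define a where "a = m \<otimes> d"
  have a: "a \<in> carrier G" "a \<preceq> x" "a \<preceq> y" using d m xy positive_closed by (auto simp: a_def shift)
  have glb: "z \<preceq> a" if z: "z \<in> carrier G" "z \<preceq> x" "z \<preceq> y" for z
  proof -
    \<comment> \<open>The meet \<open>e\<close> of \<open>x\<close> and \<open>y\<close> relative to a common lower bound \<open>l\<close> of \<open>m\<close> and \<open>z\<close> lies above
      \<open>m\<close>, hence below \<open>a\<close>.\<close>
    obtain i :: int where "\<Delta> [^] i \<preceq> m" "\<Delta> [^] i \<preceq> z" using common_Delta_pow_le m z by blast
    then obtain l where l: "l \<in> carrier G" "l \<preceq> m" "l \<preceq> z"
      using Delta_closed int_pow_closed by blast
    then have lxy: "l \<preceq> x" "l \<preceq> y" using mx le_trans by blast+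
    obtain e where e: "e \<in> P" "e \<preceq> inv l \<otimes> x" "e \<preceq> inv l \<otimes> y"
      "\<And>z. z \<in> P \<Longrightarrow> z \<preceq> inv l \<otimes> x \<Longrightarrow> z \<preceq> inv l \<otimes> y \<Longrightarrow> z \<preceq> e"
      using positive_meet[of "inv l \<otimes> x" "inv l \<otimes> y"] lxy l xy by (auto simp: le_iff)
    \<comment> \<open>Used twice: for \<open>u = m\<close>, so that \<open>l \<otimes> e\<close>
      competes with \<open>d\<close> in the meet taken relative to \<open>m\<close>, and for
      \<open>u = z\<close>.\<close>
    have e_max: "u \<preceq> l \<otimes> e" if "u \<in> carrier G" "l \<preceq> u" "u \<preceq> x" "u \<preceq> y" for u
    proof -
      have "inv l \<otimes> u \<preceq> e"
        using that l e(4)[of "inv l \<otimes> u"] xy le_mult_left[of u x "inv l"] le_mult_left[of u y "inv l"]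
        by (simp add: le_iff)
      then show ?thesis using that l e(1) positive_closed by (simp add: le_iff group_cancel)
    qed
    have le: "l \<otimes> e \<in> carrier G" "l \<otimes> e \<preceq> x" "l \<otimes> e \<preceq> y"
      using e l xy positive_closed by (auto simp: le_iff group_cancel)
    have "inv m \<otimes> (l \<otimes> e) \<preceq> d"
      using e_max[OF m l(2) mx] le m xy
        d(4)[of "inv m \<otimes> (l \<otimes> e)"] le_mult_left[of "l \<otimes> e" x "inv m"]
        le_mult_left[of "l \<otimes> e" y "inv m"] by (simp add: le_iff)
    then have "l \<otimes> e \<preceq> a"
      using le m d positive_closed le_mult_left[of "inv m \<otimes> (l \<otimes> e)" d m]
      by (simp add: a_def mult_inv_cancel_left)
    then show ?thesis using e_max[of z] z l le_trans by blast
  qed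
  show ?thesis using that[of a] a glb le_trans by blast
qed

lemma finite_meet:
  assumes "\<And>i. f i \<in> carrier G"
  shows "\<exists>a\<in>carrier G. \<forall>z\<in>carrier G. z \<preceq> a \<longleftrightarrow> (\<forall>i\<le>n::nat. z \<preceq> f i)"
proof (induction n)
  case 0
  then show ?case using assms by auto
next
  case (Suc n)
  then obtain a where a: "a \<in> carrier G" "\<And>z. z \<in> carrier G \<Longrightarrow> z \<preceq> a \<longleftrightarrow> (\<forall>i\<le>n. z \<preceq> f i)" by blast
  obtain b where "b \<in> carrier G" "\<And>z. z \<in> carrier G \<Longrightarrow> z \<preceq> b \<longleftrightarrow> z \<preceq> a \<and> z \<preceq> f (Suc n)"
    using binary_meet[OF a(1) assms[of "Suc n"]] by blast
  then show ?case using a(2) by (auto simp: le_Suc_eq intro!: bexI[of _ b])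
qed

section \<open>Conjugates with large infimum\<close>

text \<open>Some conjugate of \<open>g\<close> has infimum at least \<open>r\<close>.\<close>

definition conj_inf_ge :: "'a \<Rightarrow> int \<Rightarrow> bool" where
  "conj_inf_ge g r \<longleftrightarrow> (\<exists>x\<in>carrier G. x \<otimes> \<Delta> [^] r \<preceq> g \<otimes> x)"

text \<open>Each further factor uses both invariances: on the right under
  \<open>\<Delta> [^] r\<close>, on the left under \<open>g [^] n\<close>.\<close>

lemma le_pow_of_le:
  assumes "g \<in> carrier G" "x \<in> carrier G" "x \<otimes> \<Delta> [^] (r :: int) \<preceq> g \<otimes> x"
  shows "x \<otimes> \<Delta> [^] (int n * r) \<preceq> g [^] n \<otimes> x"
proof (induction n)
  case 0
  then show ?case using assms le_refl by simp
next
  case (Suc n)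
  have "x \<otimes> \<Delta> [^] (int n * r) \<otimes> \<Delta> [^] r \<preceq> g [^] n \<otimes> x \<otimes> \<Delta> [^] r"
    using Suc assms by (intro le_mult_Delta_pow) auto
  moreover have "g [^] n \<otimes> x \<otimes> \<Delta> [^] r \<preceq> g [^] n \<otimes> (g \<otimes> x)"
    using assms le_mult_left by (simp add: m_assoc)
  ultimately have "x \<otimes> \<Delta> [^] (int n * r) \<otimes> \<Delta> [^] r \<preceq> g [^] n \<otimes> (g \<otimes> x)"
    by (rule le_trans) (use assms in simp)
  moreover have "int (Suc n) * r = int n * r + r" by (simp add: algebra_simps)
  ultimately show ?case using assms by (simp add: Delta_pow_add m_assoc)
qed

lemma conj_inf_ge_pow:
  "g \<in> carrier G \<Longrightarrow> conj_inf_ge g r \<Longrightarrow> conj_inf_ge (g [^] n) (int n * r)"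
  using le_pow_of_le unfolding conj_inf_ge_def by blast

text \<open>The only place where meets are used: the meet over one period of the orbit of
  \<open>x\<close> replaces \<open>x\<close>.\<close>

lemma conj_inf_ge_of_pow:
  assumes g: "g \<in> carrier G" and "n \<ge> 1" and "conj_inf_ge (g [^] (n :: nat)) (int n * r)"
  shows "conj_inf_ge g r"
proof -
  obtain x where x: "x \<in> carrier G" "x \<otimes> \<Delta> [^] (int n * r) \<preceq> g [^] n \<otimes> x"
    using assms by (auto simp: conj_inf_ge_def)
  \<comment> \<open>\<open>T i\<close> is the \<open>i\<close>-th iterate, applied to
    \<open>x\<close>, of the order automorphism sending \<open>y\<close> to
    \<open>g \<otimes> y \<otimes> \<Delta> [^] (- r)\<close>.\<close>
  define T where "T i = g [^] i \<otimes> x \<otimes> \<Delta> [^] (- (int i * r))" for i :: nat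
  have T: "T i \<in> carrier G" for i using g x by (simp add: T_def)
  have T_Suc: "T (Suc i) = g \<otimes> T i \<otimes> \<Delta> [^] (- r)" for i
  proof -
    have "- (int (Suc i) * r) = - (int i * r) + - r" by (simp add: algebra_simps)
    then have "\<Delta> [^] (- (int (Suc i) * r)) = \<Delta> [^] (- (int i * r)) \<otimes> \<Delta> [^] (- r)"
      by (simp only: Delta_pow_add)
    then show ?thesis using g x nat_pow_Suc2[OF g, of i] unfolding T_def
      by (simp add: m_assoc del: nat_pow_Suc)
  qed
  have "T 0 = x" using x by (simp add: T_def)
  have "x \<otimes> \<Delta> [^] (int n * r) \<otimes> \<Delta> [^] (- (int n * r)) \<preceq> T n"
    unfolding T_def using x g by (intro le_mult_Delta_pow) auto
  then have "T 0 \<preceq> T n" using x \<open>T 0 = x\<close> by (simp add: inv_Delta_pow[symmetric] group_cancel)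
  obtain a where a: "a \<in> carrier G" "\<And>z. z \<in> carrier G \<Longrightarrow> z \<preceq> a \<longleftrightarrow> (\<forall>i\<le>n-1. z \<preceq> T i)"
    using finite_meet[of T "n - 1"] T by blast
  have aT: "a \<preceq> T i" if "i \<le> n - 1" for i using a le_refl that by blast
  \<comment> \<open>The left side is the inverse automorphism applied to \<open>a\<close>, so the
    claim amounts to \<open>a \<preceq> T (Suc i)\<close>. Only \<open>Suc i = n\<close> leaves the
    range of the meet, and there \<open>T 0 \<preceq> T n\<close> closes the cycle.\<close>
  have "inv g \<otimes> a \<otimes> \<Delta> [^] r \<preceq> T i" if "i \<le> n - 1" for i
  proof -
    have "a \<preceq> T (Suc i)"
    proof (cases "Suc i = n")
      case True
      then show ?thesis using aT[of 0] \<open>T 0 \<preceq> T n\<close> le_trans a by blast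
    next
      case False
      then have "Suc i \<le> n - 1" using that \<open>n \<ge> 1\<close> by linarith
      then show ?thesis by (rule aT)
    qed
    then have "a \<otimes> \<Delta> [^] r \<preceq> T (Suc i) \<otimes> \<Delta> [^] r" using a T by (intro le_mult_Delta_pow)
    also have "T (Suc i) \<otimes> \<Delta> [^] r = g \<otimes> T i"
      using T g by (simp add: T_Suc inv_Delta_pow[symmetric] group_cancel)
    finally show ?thesis using a T g by (simp add: le_iff group_cancel)
  qed
  then have "inv g \<otimes> a \<otimes> \<Delta> [^] r \<preceq> a" using a g by simp
  then have "a \<otimes> \<Delta> [^] r \<preceq> g \<otimes> a" using a g by (simp add: le_iff group_cancel)
  then show ?thesis using a by (auto simp: conj_inf_ge_def)
qed

text \<open>If \<open>\<Delta>\<^sup>m \<preceq> x \<preceq> \<Delta>\<^sup>M\<close> and \<open>x \<Delta>\<^sup>r \<preceq> g x\<close>, then \<open>m + n r \<le> n s + M\<close> for all \<open>n\<close>.\<close>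

lemma conj_inf_ge_bounded:
  assumes "\<Delta> \<noteq> \<one>" and g: "g \<in> carrier G" "g \<preceq> \<Delta> [^] (s :: int)" and "conj_inf_ge g r"
  shows "r \<le> s"
proof (rule ccontr)
  assume "\<not> r \<le> s"
  obtain x where x: "x \<in> carrier G" "x \<otimes> \<Delta> [^] r \<preceq> g \<otimes> x"
    using assms by (auto simp: conj_inf_ge_def)
  obtain m M :: int where m: "\<Delta> [^] m \<preceq> x" and M: "x \<preceq> \<Delta> [^] M"
    using Delta_pow_le le_Delta_pow x by metis
  have upper: "g [^] n \<preceq> \<Delta> [^] (int n * s)" for n :: nat
  proof (induction n)
    case 0
    then show ?case using le_refl by simp
  next
    case (Suc n)
    have "g [^] n \<otimes> g \<preceq> g [^] n \<otimes> \<Delta> [^] s" using g le_mult_left by simp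
    moreover have "g [^] n \<otimes> \<Delta> [^] s \<preceq> \<Delta> [^] (int n * s) \<otimes> \<Delta> [^] s"
      using Suc g by (intro le_mult_Delta_pow) auto
    ultimately have "g [^] n \<otimes> g \<preceq> \<Delta> [^] (int n * s + s)"
      using le_trans g by (simp add: Delta_pow_add)
    moreover have "int (Suc n) * s = int n * s + s" by (simp add: algebra_simps)
    ultimately show ?case by simp
  qed
  have bound: "m + int n * r \<le> int n * s + M" for n
  proof -
    have "\<Delta> [^] (m + int n * r) \<preceq> x \<otimes> \<Delta> [^] (int n * r)"
      unfolding Delta_pow_add using m x by (intro le_mult_Delta_pow) auto
    moreover have "x \<otimes> \<Delta> [^] (int n * r) \<preceq> g [^] n \<otimes> x" using le_pow_of_le g x by blast
    moreover have "g [^] n \<otimes> x \<preceq> g [^] n \<otimes> \<Delta> [^] M" using M g x le_mult_left by simp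
    moreover have "g [^] n \<otimes> \<Delta> [^] M \<preceq> \<Delta> [^] (int n * s + M)"
      unfolding Delta_pow_add using upper g by (intro le_mult_Delta_pow) auto
    ultimately have "\<Delta> [^] (m + int n * r) \<preceq> \<Delta> [^] (int n * s + M)"
      using le_trans g x by (meson Delta_closed int_pow_closed m_closed nat_pow_closed)
    then show ?thesis using Delta_pow_le_imp_le assms by blast
  qed
  \<comment> \<open>The bound says that \<open>n * (r - s)\<close> never exceeds
    \<open>M - m\<close>. Since \<open>r - s\<close> is at least 1, this fails at
    \<open>N\<close>.\<close>
  define N where "N = nat (M - m + 1)"
  have "int N * 1 \<le> int N * (r - s)" using \<open>\<not> r \<le> s\<close> by (intro mult_left_mono) auto
  moreover have "int N \<ge> M - m + 1" by (simp add: N_def)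
  ultimately show False using bound[of N] by (simp add: algebra_simps)
qed

section \<open>The infimum and its maximum over a conjugacy class\<close>

text \<open>Left translation by \<open>x\<close>; it links \<open>conj_inf_ge\<close> to actual
  conjugates.\<close>

lemma Delta_pow_le_conj_iff:
  assumes "g \<in> carrier G" "x \<in> carrier G"
  shows "\<Delta> [^] (r :: int) \<preceq> inv x \<otimes> g \<otimes> x \<longleftrightarrow> x \<otimes> \<Delta> [^] r \<preceq> g \<otimes> x"
  using assms by (simp add: le_iff group_cancel)

text \<open>The admissible exponents are closed downwards, and bounded above because
  \<open>h\<close> lies below some power of \<open>\<Delta>\<close> and
  \<open>\<Delta> \<noteq> \<one>\<close>.\<close>

lemma le_garside_inf_iff:
  assumes "\<Delta> \<noteq> \<one>" "h \<in> carrier G"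
  shows "r \<le> garside_inf G P \<Delta> h \<longleftrightarrow> \<Delta> [^] r \<preceq> h"
proof -
  let ?S = "{r :: int. \<Delta> [^] r \<preceq> h}"
  obtain k s :: int where k: "\<Delta> [^] k \<preceq> h" and s: "h \<preceq> \<Delta> [^] s"
    using Delta_pow_le le_Delta_pow assms by metis
  have "x \<le> s" if "x \<in> ?S" for x
    using Delta_pow_le_imp_le[OF assms(1)] le_trans[OF _ s] that by simp
  moreover have "k \<in> ?S" using k by simp
  ultimately have max: "int_max ?S \<in> ?S" "\<And>x. x \<in> ?S \<Longrightarrow> x \<le> int_max ?S"
    using int_max_bounded[of k ?S s] by blast+
  show ?thesis
  proof
    assume "r \<le> garside_inf G P \<Delta> h"
    moreover have "\<Delta> [^] garside_inf G P \<Delta> h \<preceq> h" using max(1) unfolding garside_inf_def by simp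
    ultimately show "\<Delta> [^] r \<preceq> h" by (rule le_trans[OF Delta_pow_mono]) simp
  next
    assume "\<Delta> [^] r \<preceq> h"
    then show "r \<le> garside_inf G P \<Delta> h" using max(2)[of r] unfolding garside_inf_def by simp
  qed
qed

text \<open>An exponent \<open>s\<close> with \<open>g \<preceq> \<Delta> [^] s\<close> bounds the
  infima of all conjugates by \<open>conj_inf_ge_bounded\<close>, so the maximum defining
  \<open>inf_s\<close> is attained.\<close>

lemma le_inf_s_iff:
  assumes "\<Delta> \<noteq> \<one>" "g \<in> carrier G"
  shows "r \<le> inf_s G P \<Delta> g \<longleftrightarrow> conj_inf_ge g r"
proof -
  let ?S = "garside_inf G P \<Delta> ` conjugacy_class G g"
  have conj: "conj_inf_ge g k \<longleftrightarrow> (\<exists>h\<in>conjugacy_class G g. k \<le> garside_inf G P \<Delta> h)" for k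
    using assms le_garside_inf_iff Delta_pow_le_conj_iff
    by (auto simp: conj_inf_ge_def conjugacy_class_def)
  obtain s :: int where s: "g \<preceq> \<Delta> [^] s" using le_Delta_pow assms by blast
  have bounded: "x \<le> s" if "x \<in> ?S" for x
    using conj_inf_ge_bounded[OF assms s] that conj by blast
  have "inv \<one> \<otimes> g \<otimes> \<one> \<in> conjugacy_class G g" unfolding conjugacy_class_def by blast
  note max = int_max_bounded[where S = ?S, OF imageI[OF this] bounded]
  show ?thesis
  proof
    assume "r \<le> inf_s G P \<Delta> g"
    then show "conj_inf_ge g r" using max(1) conj unfolding inf_s_def by auto
  next
    assume "conj_inf_ge g r"
    then obtain h where "h \<in> conjugacy_class G g" "r \<le> garside_inf G P \<Delta> h" using conj by blast
    then show "r \<le> inf_s G P \<Delta> g" using max(2) unfolding inf_s_def by fastforce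
  qed
qed

text \<open>Here every integer is an admissible exponent, no maximum exists, and
  \<open>int_max\<close> returns its default 0.\<close>

lemma inf_s_trivial:
  assumes "\<Delta> = \<one>" "g \<in> carrier G"
  shows "inf_s G P \<Delta> g = 0"
proof -
  have triv: "carrier G = {\<one>}" using carrier_trivial assms by simp
  then have "g = \<one>" using assms by simp
  have "{r :: int. \<Delta> [^] r \<preceq> \<one>} = UNIV"
    using assms le_refl int_pow_one by simp
  moreover have "int_max UNIV = 0"
    unfolding int_max_def by (metis UNIV_I gt_ex leD)
  ultimately have "garside_inf G P \<Delta> \<one> = 0" by (simp add: garside_inf_def)
  moreover have "conjugacy_class G \<one> = {\<one>}" using triv by (auto simp: conjugacy_class_def)
  moreover have "int_max {0} = 0" by (rule int_max_eqI) auto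
  ultimately show ?thesis using \<open>g = \<one>\<close> by (simp add: inf_s_def)
qed

lemma inf_s_pow_bounds:
  assumes "g \<in> carrier G" "n \<ge> 1"
  shows "int n * inf_s G P \<Delta> g \<le> inf_s G P \<Delta> (g [^] n)"
    and "inf_s G P \<Delta> (g [^] n) < int n * (inf_s G P \<Delta> g + 1)"
proof -
  show "int n * inf_s G P \<Delta> g \<le> inf_s G P \<Delta> (g [^] n)"
  proof (cases "\<Delta> = \<one>")
    case True
    show ?thesis using inf_s_trivial[OF True] assms nat_pow_closed by simp
  next
    case False
    then have "conj_inf_ge g (inf_s G P \<Delta> g)" using le_inf_s_iff assms by blast
    then show ?thesis using conj_inf_ge_pow le_inf_s_iff False assms nat_pow_closed by blast
  qed
  show "inf_s G P \<Delta> (g [^] n) < int n * (inf_s G P \<Delta> g + 1)"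
  proof (cases "\<Delta> = \<one>")
    case True
    show ?thesis using inf_s_trivial[OF True] assms nat_pow_closed by simp
  next
    case False
    \<comment> \<open>Maximality of \<open>inf_s\<close> passes to the power by the contrapositive
      of \<open>conj_inf_ge_of_pow\<close>, which yields the strict bound.\<close>
    have "\<not> conj_inf_ge g (inf_s G P \<Delta> g + 1)"
      using le_inf_s_iff[OF False, of g "inf_s G P \<Delta> g + 1"] assms by simp
    then have "\<not> conj_inf_ge (g [^] n) (int n * (inf_s G P \<Delta> g + 1))"
      using conj_inf_ge_of_pow assms by blast
    then show ?thesis using le_inf_s_iff[OF False] assms nat_pow_closed not_le by blast
  qed
qed

section \<open>Suprema by inversion\<close>

text \<open>No case distinction on \<open>\<Delta> = \<one>\<close> arises, since
  \<open>int_min_uminus\<close> respects the default values.\<close>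

lemma garside_sup_eq:
  assumes "h \<in> carrier G"
  shows "garside_sup G P \<Delta> h = - garside_inf G P \<Delta> (inv h)"
proof -
  have "{s :: int. h \<preceq> \<Delta> [^] s} = uminus ` {r :: int. \<Delta> [^] r \<preceq> inv h}"
  proof (intro subset_antisym subsetI)
    fix s :: int
    assume "s \<in> {s. h \<preceq> \<Delta> [^] s}"
    then show "s \<in> uminus ` {r. \<Delta> [^] r \<preceq> inv h}"
      using le_Delta_pow_iff_inv[OF assms] by (intro image_eqI[of _ _ "- s"]) simp_all
  next
    fix s :: int
    assume "s \<in> uminus ` {r. \<Delta> [^] r \<preceq> inv h}"
    then obtain r where "s = - r" "\<Delta> [^] r \<preceq> inv h" by blast
    then show "s \<in> {s. h \<preceq> \<Delta> [^] s}" using le_Delta_pow_iff_inv[OF assms, of s] by simp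
  qed
  then show ?thesis by (simp add: garside_sup_def garside_inf_def int_min_uminus)
qed

lemma sup_s_eq:
  assumes "g \<in> carrier G"
  shows "sup_s G P \<Delta> g = - inf_s G P \<Delta> (inv g)"
proof -
  have "conjugacy_class G g \<subseteq> carrier G" using assms by (auto simp: conjugacy_class_def)
  then have "garside_sup G P \<Delta> ` conjugacy_class G g =
      (\<lambda>h. - garside_inf G P \<Delta> (inv h)) ` conjugacy_class G g"
    by (intro image_cong) (auto simp: garside_sup_eq)
  also have "\<dots> = uminus ` garside_inf G P \<Delta> ` conjugacy_class G (inv g)"
    unfolding inv_image_conjugacy_class[OF assms, symmetric] by (simp add: image_image)
  finally show ?thesis by (simp add: sup_s_def inf_s_def int_min_uminus)
qed

text \<open>The bounds for \<open>inv g\<close> with signs reversed, which moves the strict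
  inequality to the lower side.\<close>

lemma sup_s_pow_bounds:
  assumes "g \<in> carrier G" "n \<ge> 1"
  shows "int n * (sup_s G P \<Delta> g - 1) < sup_s G P \<Delta> (g [^] n)"
    and "sup_s G P \<Delta> (g [^] n) \<le> int n * sup_s G P \<Delta> g"
  using inf_s_pow_bounds[of "inv g" n] assms
  by (simp_all add: sup_s_eq nat_pow_inv algebra_simps)

end

theorem theorem6p1:
  fixes G :: "('a, 'b) monoid_scheme" (structure)
    and P :: "'a set" and \<Delta> g :: 'a and n :: nat
  assumes "garside_group G P"
    and "garside_element (G\<lparr>carrier := P\<rparr>) \<Delta>"
    and "g \<in> carrier G"
    and "n \<ge> 1"
  shows "(real_of_int (inf_s G P \<Delta> g) \<le> real_of_int (inf_s G P \<Delta> (g [^] n)) / real n \<and>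
          real_of_int (inf_s G P \<Delta> (g [^] n)) / real n < real_of_int (inf_s G P \<Delta> g) + 1) \<and>
         (real_of_int (sup_s G P \<Delta> g) - 1 < real_of_int (sup_s G P \<Delta> (g [^] n)) / real n \<and>
          real_of_int (sup_s G P \<Delta> (g [^] n)) / real n \<le> real_of_int (sup_s G P \<Delta> g)) \<and>
         (real_of_int (len_s G P \<Delta> g) - 2 < real_of_int (len_s G P \<Delta> (g [^] n)) / real n \<and>
          real_of_int (len_s G P \<Delta> (g [^] n)) / real n \<le> real_of_int (len_s G P \<Delta> g))"
proof -
  interpret garside_group_with_element G P \<Delta>
    using assms by (simp add: garside_group_with_element_def garside_group_with_element_axioms_def)
  define i j s t where "i = inf_s G P \<Delta> g" and "j = inf_s G P \<Delta> (g [^] n)"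
    and "s = sup_s G P \<Delta> g" and "t = sup_s G P \<Delta> (g [^] n)"
  have "int n * i \<le> j" "j < int n * (i + 1)" "int n * (s - 1) < t" "t \<le> int n * s"
    using inf_s_pow_bounds sup_s_pow_bounds assms unfolding i_def j_def s_def t_def by blast+
  then have "real_of_int (int n * i) \<le> real_of_int j" "real_of_int j < real_of_int (int n * (i + 1))"
    "real_of_int (int n * (s - 1)) < real_of_int t" "real_of_int t \<le> real_of_int (int n * s)"
    by (simp_all only: of_int_le_iff of_int_less_iff)
  then have b: "real_of_int i \<le> j / real n" "j / real n < real_of_int i + 1"
    "real_of_int s - 1 < t / real n" "t / real n \<le> real_of_int s"
    using assms(4) by (simp_all add: field_simps)
  \<comment> \<open>The lower estimate for the length combines two strict bounds, each losing 1,
    hence the 2; the upper one combines the two exact bounds.\<close>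
  have "real_of_int (t - j) / real n = t / real n - j / real n" by (simp add: diff_divide_distrib)
  then have "real_of_int (s - i) - 2 < real_of_int (t - j) / real n"
    "real_of_int (t - j) / real n \<le> real_of_int (s - i)"
    using b by simp_all
  then show ?thesis using b unfolding i_def j_def s_def t_def len_s_def by blast
qed

end
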